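(* Let $X$ be a set, let $z\in X$ and let $X^-=X\smallsetminus\{z\}$. The free medial quandle over $X$ is isomorphic to a subquandle of the affine quandle $\mathrm{Aff}\big(\bigoplus_{x\in X^-}\mathbb{Z}[t,t^{-1}],\,t\big)$.
   Context: A quandle is a set $Q$ with a binary operation $\ast$ such that, for all $x,y,z\in Q$: $x\ast(y\ast z)=(x\ast y)\ast(x\ast z)$; the equation $x\ast u=y$ has a unique solution $u\in Q$, denoted $x\backslash y$; and $x\ast x=x$. It is medial if $(x\ast y)\ast(u\ast v)=(x\ast u)\ast(y\ast v)$ for all $x,y,u,v\in Q$. With the operations $\ast,\backslash$ medial quandles form a variety, and the free medial quandle over $X$ is the free algebra over $X$ in this variety; subquandles are subsets closed under $\ast$ and $\backslash$. For a $\mathbb{Z}[t,t^{-1}]$-module $A$, the affine quandle $\mathrm{Aff}(A,t)$ is the set $A$ with the operation $a\ast b=(1-t)\cdot a+t\cdot b$. *)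

theory Defs
  imports Complex_Main "HOL-Library.Poly_Mapping"
begin

subsection \<open>Medial quandles\<close>

text \<open>An algebra is given by a carrier \<open>Q\<close> and an operation \<open>f\<close>; the operation is
  only relevant on the carrier.\<close>

locale quandle =
  fixes Q :: "'q set" and f :: "'q \<Rightarrow> 'q \<Rightarrow> 'q"
  assumes closed: "\<lbrakk>x \<in> Q; y \<in> Q\<rbrakk> \<Longrightarrow> f x y \<in> Q"
    and left_distrib: "\<lbrakk>x \<in> Q; y \<in> Q; z \<in> Q\<rbrakk> \<Longrightarrow> f x (f y z) = f (f x y) (f x z)"
    and unique_solution: "\<lbrakk>x \<in> Q; y \<in> Q\<rbrakk> \<Longrightarrow> \<exists>!u. u \<in> Q \<and> f x u = y"
    and idem: "x \<in> Q \<Longrightarrow> f x x = x"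

locale medial_quandle = quandle +
  assumes medial: "\<lbrakk>x \<in> Q; y \<in> Q; u \<in> Q; v \<in> Q\<rbrakk> \<Longrightarrow> f (f x y) (f u v) = f (f x u) (f y v)"

definition left_div :: "'q set \<Rightarrow> ('q \<Rightarrow> 'q \<Rightarrow> 'q) \<Rightarrow> 'q \<Rightarrow> 'q \<Rightarrow> 'q" where
  "left_div Q f x y = (THE u. u \<in> Q \<and> f x u = y)"

definition subquandle :: "'q set \<Rightarrow> 'q set \<Rightarrow> ('q \<Rightarrow> 'q \<Rightarrow> 'q) \<Rightarrow> bool" where
  "subquandle S Q f \<longleftrightarrow> S \<subseteq> Q \<and>
     (\<forall>x\<in>S. \<forall>y\<in>S. f x y \<in> S) \<and> (\<forall>x\<in>S. \<forall>y\<in>S. left_div Q f x y \<in> S)"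

definition quandle_hom :: "'p set \<Rightarrow> ('p \<Rightarrow> 'p \<Rightarrow> 'p) \<Rightarrow> 'q set \<Rightarrow> ('q \<Rightarrow> 'q \<Rightarrow> 'q) \<Rightarrow> ('p \<Rightarrow> 'q) \<Rightarrow> bool" where
  "quandle_hom P f Q g h \<longleftrightarrow> h ` P \<subseteq> Q \<and> (\<forall>x\<in>P. \<forall>y\<in>P. h (f x y) = g (h x) (h y))"

definition quandle_isomorphic :: "'p set \<Rightarrow> ('p \<Rightarrow> 'p \<Rightarrow> 'p) \<Rightarrow> 'q set \<Rightarrow> ('q \<Rightarrow> 'q \<Rightarrow> 'q) \<Rightarrow> bool" where
  "quandle_isomorphic P f Q g \<longleftrightarrow> (\<exists>h. quandle_hom P f Q g h \<and> bij_betw h P Q)"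

context quandle
begin

lemma left_div_unique: "\<lbrakk>x \<in> Q; u \<in> Q; f x u = y\<rbrakk> \<Longrightarrow> left_div Q f x y = u"
  unfolding left_div_def using unique_solution[of x "f x u"] closed by (intro the_equality) auto

lemma left_div_closed: "\<lbrakk>x \<in> Q; y \<in> Q\<rbrakk> \<Longrightarrow> left_div Q f x y \<in> Q"
  using unique_solution left_div_unique by metis

lemma mult_left_div: "\<lbrakk>x \<in> Q; y \<in> Q\<rbrakk> \<Longrightarrow> f x (left_div Q f x y) = y"
  using unique_solution left_div_unique by metis

lemma left_div_mult: "\<lbrakk>x \<in> Q; y \<in> Q\<rbrakk> \<Longrightarrow> left_div Q f x (f x y) = y"
  by (rule left_div_unique) auto

end

lemma quandle_hom_left_div:
  assumes "quandle P f" "quandle Q g" "quandle_hom P f Q g h" "x \<in> P" "y \<in> P"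
  shows "h (left_div P f x y) = left_div Q g (h x) (h y)"
proof -
  interpret P: quandle P f by fact
  interpret Q: quandle Q g by fact
  have "g (h x) (h (left_div P f x y)) = h y"
    using assms P.left_div_closed P.mult_left_div unfolding quandle_hom_def by metis
  then show ?thesis
    using assms P.left_div_closed Q.left_div_unique unfolding quandle_hom_def by (metis image_subset_iff)
qed


subsection \<open>The free medial quandle\<close>

text \<open>The free algebra over \<open>X\<close> in the variety is the algebra of terms over \<open>X\<close> in the
  two operations, modulo the least congruence that contains all instances of the defining
  identities.\<close>

datatype (vars: 'a) qterm = Var 'a | Mult "'a qterm" "'a qterm" | LDiv "'a qterm" "'a qterm"

definition qterms :: "'a set \<Rightarrow> 'a qterm set" where
  "qterms X = {s. vars s \<subseteq> X}"

inductive mq_eq :: "'a set \<Rightarrow> 'a qterm \<Rightarrow> 'a qterm \<Rightarrow> bool" for X :: "'a set" where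
  refl: "s \<in> qterms X \<Longrightarrow> mq_eq X s s"
| sym: "mq_eq X s t \<Longrightarrow> mq_eq X t s"
| trans: "\<lbrakk>mq_eq X s t; mq_eq X t u\<rbrakk> \<Longrightarrow> mq_eq X s u"
| cong_Mult: "\<lbrakk>mq_eq X s s'; mq_eq X t t'\<rbrakk> \<Longrightarrow> mq_eq X (Mult s t) (Mult s' t')"
| cong_LDiv: "\<lbrakk>mq_eq X s s'; mq_eq X t t'\<rbrakk> \<Longrightarrow> mq_eq X (LDiv s t) (LDiv s' t')"
| left_distrib: "\<lbrakk>s \<in> qterms X; t \<in> qterms X; u \<in> qterms X\<rbrakk> \<Longrightarrow>
    mq_eq X (Mult s (Mult t u)) (Mult (Mult s t) (Mult s u))"
| LDiv_Mult: "\<lbrakk>s \<in> qterms X; t \<in> qterms X\<rbrakk> \<Longrightarrow> mq_eq X (LDiv s (Mult s t)) t"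
| Mult_LDiv: "\<lbrakk>s \<in> qterms X; t \<in> qterms X\<rbrakk> \<Longrightarrow> mq_eq X (Mult s (LDiv s t)) t"
| idem: "s \<in> qterms X \<Longrightarrow> mq_eq X (Mult s s) s"
| medial: "\<lbrakk>s \<in> qterms X; t \<in> qterms X; u \<in> qterms X; v \<in> qterms X\<rbrakk> \<Longrightarrow>
    mq_eq X (Mult (Mult s t) (Mult u v)) (Mult (Mult s u) (Mult t v))"

definition mq_rel :: "'a set \<Rightarrow> ('a qterm \<times> 'a qterm) set" where
  "mq_rel X = {(s, t). mq_eq X s t}"

definition free_medial_quandle :: "'a set \<Rightarrow> 'a qterm set set" where
  "free_medial_quandle X = qterms X // mq_rel X"

definition fmq_mult :: "'a set \<Rightarrow> 'a qterm set \<Rightarrow> 'a qterm set \<Rightarrow> 'a qterm set" where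
  "fmq_mult X A B = (\<Union>s\<in>A. \<Union>t\<in>B. mq_rel X `` {Mult s t})"

abbreviation fmq_class :: "'a set \<Rightarrow> 'a qterm \<Rightarrow> 'a qterm set" where
  "fmq_class X s \<equiv> mq_rel X `` {s}"

lemma qterms_simps [simp]:
  "Var x \<in> qterms X \<longleftrightarrow> x \<in> X"
  "Mult s t \<in> qterms X \<longleftrightarrow> s \<in> qterms X \<and> t \<in> qterms X"
  "LDiv s t \<in> qterms X \<longleftrightarrow> s \<in> qterms X \<and> t \<in> qterms X"
  by (auto simp: qterms_def)

lemma mq_eq_qterms: "mq_eq X s t \<Longrightarrow> s \<in> qterms X \<and> t \<in> qterms X"
  by (induction rule: mq_eq.induct) auto

lemma equiv_mq_rel: "equiv (qterms X) (mq_rel X)"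
  by (intro equivI refl_onI symI transI)
     (auto simp: mq_rel_def dest: mq_eq_qterms intro: mq_eq.refl mq_eq.sym mq_eq.trans)

lemma fmq_class_eq_iff:
  "\<lbrakk>s \<in> qterms X; t \<in> qterms X\<rbrakk> \<Longrightarrow> fmq_class X s = fmq_class X t \<longleftrightarrow> mq_eq X s t"
  using eq_equiv_class_iff[OF equiv_mq_rel, of s X t] by (simp add: mq_rel_def)

lemma fmq_class_in: "s \<in> qterms X \<Longrightarrow> fmq_class X s \<in> free_medial_quandle X"
  unfolding free_medial_quandle_def by (rule quotientI)

lemma fmq_cases:
  assumes "A \<in> free_medial_quandle X"
  obtains s where "s \<in> qterms X" "A = fmq_class X s"
  using assms unfolding free_medial_quandle_def by (rule quotientE)

lemma fmq_mult_class:
  assumes "s \<in> qterms X" "t \<in> qterms X"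
  shows "fmq_mult X (fmq_class X s) (fmq_class X t) = fmq_class X (Mult s t)"
proof -
  have "congruent2 (mq_rel X) (mq_rel X) (\<lambda>s t. fmq_class X (Mult s t))"
    unfolding congruent2_def
    by (auto simp: mq_rel_def fmq_class_eq_iff[unfolded mq_rel_def] dest: mq_eq_qterms
             intro!: mq_eq.cong_Mult)
       (meson mq_eq.cong_Mult mq_eq.sym mq_eq.trans)+
  from UN_equiv_class2[OF equiv_mq_rel equiv_mq_rel this assms] show ?thesis
    unfolding fmq_mult_def .
qed

lemma fmq_left_div_aux:
  assumes "s \<in> qterms X" "t \<in> qterms X" "u \<in> qterms X"
  shows "fmq_mult X (fmq_class X s) (fmq_class X u) = fmq_class X t \<longleftrightarrow>
    fmq_class X u = fmq_class X (LDiv s t)"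
  using assms
  by (simp add: fmq_mult_class fmq_class_eq_iff)
     (metis mq_eq.LDiv_Mult mq_eq.Mult_LDiv mq_eq.cong_LDiv mq_eq.cong_Mult mq_eq.refl
        mq_eq.sym mq_eq.trans)

theorem medial_quandle_free: "medial_quandle (free_medial_quandle X) (fmq_mult X)"
proof
  fix A B assume "A \<in> free_medial_quandle X" "B \<in> free_medial_quandle X"
  then obtain s t where st: "s \<in> qterms X" "t \<in> qterms X"
    "A = fmq_class X s" "B = fmq_class X t" by (metis fmq_cases)
  show "fmq_mult X A B \<in> free_medial_quandle X"
    using st by (simp add: fmq_mult_class fmq_class_in)
  show "\<exists>!U. U \<in> free_medial_quandle X \<and> fmq_mult X A U = B"
  proof (rule ex1I[of _ "fmq_class X (LDiv s t)"])
    show "fmq_class X (LDiv s t) \<in> free_medial_quandle X \<and> fmq_mult X A (fmq_class X (LDiv s t)) = B"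
      using st fmq_left_div_aux[of s X t "LDiv s t"] by (simp add: fmq_class_in)
  next
    fix U assume U: "U \<in> free_medial_quandle X \<and> fmq_mult X A U = B"
    then obtain u where "u \<in> qterms X" "U = fmq_class X u" by (metis fmq_cases)
    with U st fmq_left_div_aux[of s X t u] show "U = fmq_class X (LDiv s t)" by simp
  qed
next
  fix A assume "A \<in> free_medial_quandle X"
  then obtain s where "s \<in> qterms X" "A = fmq_class X s" by (rule fmq_cases)
  then show "fmq_mult X A A = A"
    by (simp only: fmq_mult_class fmq_class_eq_iff qterms_simps mq_eq.idem)
next
  fix A B C assume "A \<in> free_medial_quandle X" "B \<in> free_medial_quandle X" "C \<in> free_medial_quandle X"
  then obtain s t u where "s \<in> qterms X" "A = fmq_class X s" "t \<in> qterms X" "B = fmq_class X t"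
    "u \<in> qterms X" "C = fmq_class X u" by (elim fmq_cases)
  then show "fmq_mult X A (fmq_mult X B C) = fmq_mult X (fmq_mult X A B) (fmq_mult X A C)"
    by (simp only: fmq_mult_class fmq_class_eq_iff qterms_simps mq_eq.left_distrib)
next
  fix A B C D
  assume "A \<in> free_medial_quandle X" "B \<in> free_medial_quandle X"
    "C \<in> free_medial_quandle X" "D \<in> free_medial_quandle X"
  then obtain s t u v where "s \<in> qterms X" "A = fmq_class X s" "t \<in> qterms X" "B = fmq_class X t"
    "u \<in> qterms X" "C = fmq_class X u" "v \<in> qterms X" "D = fmq_class X v" by (elim fmq_cases)
  then show "fmq_mult X (fmq_mult X A B) (fmq_mult X C D) = fmq_mult X (fmq_mult X A C) (fmq_mult X B D)"
    by (simp only: fmq_mult_class fmq_class_eq_iff qterms_simps mq_eq.medial)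
qed

lemma left_div_fmq:
  assumes "s \<in> qterms X" "t \<in> qterms X"
  shows "left_div (free_medial_quandle X) (fmq_mult X) (fmq_class X s) (fmq_class X t) =
    fmq_class X (LDiv s t)"
proof -
  interpret medial_quandle "free_medial_quandle X" "fmq_mult X" by (rule medial_quandle_free)
  show ?thesis
    using assms fmq_left_div_aux[of s X t "LDiv s t"] by (intro left_div_unique) (auto simp: fmq_class_in)
qed

primrec qeval :: "'q set \<Rightarrow> ('q \<Rightarrow> 'q \<Rightarrow> 'q) \<Rightarrow> ('a \<Rightarrow> 'q) \<Rightarrow> 'a qterm \<Rightarrow> 'q" where
  "qeval Q f e (Var x) = e x"
| "qeval Q f e (Mult s t) = f (qeval Q f e s) (qeval Q f e t)"
| "qeval Q f e (LDiv s t) = left_div Q f (qeval Q f e s) (qeval Q f e t)"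

lemma (in quandle) qeval_closed: "\<lbrakk>e ` X \<subseteq> Q; s \<in> qterms X\<rbrakk> \<Longrightarrow> qeval Q f e s \<in> Q"
  by (induction s) (auto intro: closed left_div_closed)

lemma (in medial_quandle) qeval_mq_eq:
  assumes "mq_eq X s t" "e ` X \<subseteq> Q"
  shows "qeval Q f e s = qeval Q f e t"
  using assms(1)
proof induction
  case left_distrib then show ?case
    unfolding qeval.simps by (intro quandle.left_distrib[OF quandle_axioms] qeval_closed[OF assms(2)])
next
  case medial then show ?case
    unfolding qeval.simps by (intro medial_quandle.medial[OF medial_quandle_axioms] qeval_closed[OF assms(2)])
next
  case idem then show ?case
    unfolding qeval.simps by (intro quandle.idem[OF quandle_axioms] qeval_closed[OF assms(2)])
next
  case LDiv_Mult then show ?case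
    unfolding qeval.simps by (intro left_div_mult qeval_closed[OF assms(2)])
next
  case Mult_LDiv then show ?case
    unfolding qeval.simps by (intro mult_left_div qeval_closed[OF assms(2)])
qed auto

theorem fmq_universal_property:
  assumes "medial_quandle Q g" "e ` X \<subseteq> Q"
  shows "\<exists>h. quandle_hom (free_medial_quandle X) (fmq_mult X) Q g h \<and>
      (\<forall>x\<in>X. h (fmq_class X (Var x)) = e x)"
    and "\<lbrakk>quandle_hom (free_medial_quandle X) (fmq_mult X) Q g h;
        quandle_hom (free_medial_quandle X) (fmq_mult X) Q g h';
        \<forall>x\<in>X. h (fmq_class X (Var x)) = e x; \<forall>x\<in>X. h' (fmq_class X (Var x)) = e x;
        A \<in> free_medial_quandle X\<rbrakk> \<Longrightarrow> h A = h' A"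
proof -
  interpret Q: medial_quandle Q g by fact
  interpret F: medial_quandle "free_medial_quandle X" "fmq_mult X" by (rule medial_quandle_free)
  define h where "h A = qeval Q g e (SOME s. s \<in> A)" for A
  have h: "h (fmq_class X s) = qeval Q g e s" if s: "s \<in> qterms X" for s
  proof -
    have "s \<in> fmq_class X s" using s by (auto simp: mq_rel_def intro: mq_eq.refl)
    then have "(SOME t. t \<in> fmq_class X s) \<in> fmq_class X s" by (rule someI)
    then have "mq_eq X s (SOME t. t \<in> fmq_class X s)" by (simp add: mq_rel_def)
    from Q.qeval_mq_eq[OF this assms(2)] show ?thesis by (simp add: h_def)
  qed
  have "quandle_hom (free_medial_quandle X) (fmq_mult X) Q g h"
    unfolding quandle_hom_def
    by (auto elim!: fmq_cases simp: fmq_mult_class h intro!: Q.qeval_closed[OF assms(2)])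
  then show "\<exists>h. quandle_hom (free_medial_quandle X) (fmq_mult X) Q g h \<and>
      (\<forall>x\<in>X. h (fmq_class X (Var x)) = e x)"
    using h by (intro exI[of _ h]) simp
  have *: "k (fmq_class X s) = qeval Q g e s"
    if k: "quandle_hom (free_medial_quandle X) (fmq_mult X) Q g k"
      "\<forall>x\<in>X. k (fmq_class X (Var x)) = e x" and "s \<in> qterms X" for k s
    using that(3)
  proof (induction s)
    case (Var x) then show ?case using k(2) by simp
  next
    case (Mult s t)
    then have "k (fmq_mult X (fmq_class X s) (fmq_class X t)) = g (k (fmq_class X s)) (k (fmq_class X t))"
      using k(1) fmq_class_in[of s X] fmq_class_in[of t X] unfolding quandle_hom_def
      by (simp del: Image_singleton_iff)
    with Mult show ?case by (simp add: fmq_mult_class)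
  next
    case (LDiv s t)
    then show ?case
      using quandle_hom_left_div[OF F.quandle_axioms Q.quandle_axioms k(1),
          of "fmq_class X s" "fmq_class X t"]
      by (simp add: left_div_fmq fmq_class_in)
  qed
  show "h A = h' A" if "quandle_hom (free_medial_quandle X) (fmq_mult X) Q g h"
     "quandle_hom (free_medial_quandle X) (fmq_mult X) Q g h'"
     "\<forall>x\<in>X. h (fmq_class X (Var x)) = e x" "\<forall>x\<in>X. h' (fmq_class X (Var x)) = e x"
     "A \<in> free_medial_quandle X" for h h' A
    using that(5) *[OF that(1,3)] *[OF that(2,4)] by (auto elim!: fmq_cases simp del: Image_singleton_iff)
qed


subsection \<open>Laurent polynomials and affine quandles\<close>

text \<open>Finitely supported maps from exponents to coefficients under convolution, i.e. the
  group ring of the infinite cyclic group, which is $\mathbb{Z}[t,t^{-1}]$.\<close>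

type_synonym laurent = "int \<Rightarrow>\<^sub>0 int"

definition laurent_t :: laurent where
  "laurent_t = Poly_Mapping.single 1 1"

lemma laurent_t_invertible:
  "laurent_t * Poly_Mapping.single (- 1) 1 = 1" "Poly_Mapping.single (- 1) 1 * laurent_t = 1"
  by (simp_all add: laurent_t_def mult_single)

text \<open>The operation of $\mathrm{Aff}(A,t)$, for scalar multiplication \<open>scale\<close> on the
  module.\<close>

definition aff_op :: "(laurent \<Rightarrow> 'b \<Rightarrow> 'b) \<Rightarrow> 'b \<Rightarrow> 'b \<Rightarrow> 'b::ab_group_add" where
  "aff_op scale a b = scale (1 - laurent_t) a + scale laurent_t b"

lemma (in module) medial_quandle_aff_aux:
  fixes a :: 'a
  assumes "a * a' = 1" "subspace A"
  shows "medial_quandle A (\<lambda>x y. scale (1 - a) x + scale a y)"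
proof
  fix x y assume xy: "x \<in> A" "y \<in> A"
  show "scale (1 - a) x + scale a y \<in> A"
    using xy assms(2) by (intro subspace_add subspace_scale)
  have a'a: "a' * a = 1" using assms(1) by (simp add: mult.commute)
  show "\<exists>!u. u \<in> A \<and> scale (1 - a) x + scale a u = y"
  proof (rule ex1I[of _ "scale a' (y - scale (1 - a) x)"])
    show "scale a' (y - scale (1 - a) x) \<in> A \<and>
        scale (1 - a) x + scale a (scale a' (y - scale (1 - a) x)) = y"
      using xy assms by (auto intro!: subspace_diff subspace_scale)
  next
    fix u assume "u \<in> A \<and> scale (1 - a) x + scale a u = y"
    then have "y - scale (1 - a) x = scale a u" by auto
    then show "u = scale a' (y - scale (1 - a) x)" using a'a by simp
  qed
qed (auto simp: algebra_simps)

text \<open>The direct sum of copies of the ring indexed by \<open>I\<close>, as the finitely supported maps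
  on the whole type whose support lies in \<open>I\<close>.\<close>

definition dsum :: "'a set \<Rightarrow> ('a \<Rightarrow>\<^sub>0 laurent) set" where
  "dsum I = {p. Poly_Mapping.keys p \<subseteq> I}"

definition dsum_scale :: "laurent \<Rightarrow> ('a \<Rightarrow>\<^sub>0 laurent) \<Rightarrow> ('a \<Rightarrow>\<^sub>0 laurent)" where
  "dsum_scale c p = Poly_Mapping.map (\<lambda>r. c * r) p"

lemma lookup_dsum_scale [simp]:
  "Poly_Mapping.lookup (dsum_scale c p) x = c * Poly_Mapping.lookup p x"
  unfolding dsum_scale_def by (transfer, auto simp: when_def)

lemma module_dsum: "module (dsum_scale :: laurent \<Rightarrow> ('a \<Rightarrow>\<^sub>0 laurent) \<Rightarrow> _)"
  by standard (auto intro!: poly_mapping_eqI simp: lookup_add algebra_simps)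

lemma subspace_dsum: "module.subspace dsum_scale (dsum I)"
  unfolding module.subspace_def[OF module_dsum]
  by (auto simp: dsum_def in_keys_iff subset_iff lookup_add) (metis add.right_neutral)

theorem medial_quandle_aff_dsum: "medial_quandle (dsum I) (aff_op dsum_scale)"
  unfolding aff_op_def
  by (rule module.medial_quandle_aff_aux[OF module_dsum laurent_t_invertible(1) subspace_dsum])

end

theory Submission
  imports "HOL-Algebra.Free_Abelian_Groups" "HOL-Algebra.Bij" Defs
begin

text \<open>Write \<open>L a\<close> for the left translation by \<open>a\<close>. In a medial quandle the permutations
  \<open>L a \<circ> inv (L b)\<close> generate an abelian group, the displacement group, on which conjugation by
  any translation is one and the same automorphism; this makes it a $\mathbb{Z}[t,t^{-1}]$-module.
  For the free medial quandle over \<open>X\<close> there is therefore a module homomorphism \<open>\<phi>\<close> from the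
  free module over \<open>X - {z}\<close> to the displacement group with \<open>\<phi> (e x) = L x \<circ> inv (L z)\<close>, and with
  \<open>e z = 0\<close> one gets
  \[ \phi(a)(x) * \phi(b)(y) = \phi((1-t)a + tb + e_x - e_y)(y). \]
  Let \<open>h\<close> be the homomorphism to the affine quandle with \<open>h x = e x\<close>. By induction on terms,
  every element has the form \<open>\<phi> a x\<close> with image \<open>(1 - t) a + e x\<close> under \<open>h\<close>. This image determines
  \<open>x\<close> and \<open>a\<close>, as \<open>1 - t\<close> is neither a zero divisor nor a divisor of a non-zero integer. Hence \<open>h\<close>
  is injective.\<close>

section \<open>Groups generated by commuting elements\<close>

lemma (in group) subgroup_centralizer:
  assumes "a \<in> carrier G"
  shows "subgroup {h \<in> carrier G. h \<otimes> a = a \<otimes> h} G"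
proof (rule subgroupI)
  fix h assume "h \<in> {h \<in> carrier G. h \<otimes> a = a \<otimes> h}"
  then have h: "h \<in> carrier G" "h \<otimes> a = a \<otimes> h" by auto
  have "inv h \<otimes> a = a \<otimes> inv h"
    using assms h by (metis inv_closed inv_solve_left inv_solve_right m_assoc m_closed)
  with h show "inv h \<in> {h \<in> carrier G. h \<otimes> a = a \<otimes> h}" by simp
next
  fix h k assume "h \<in> {h \<in> carrier G. h \<otimes> a = a \<otimes> h}" "k \<in> {h \<in> carrier G. h \<otimes> a = a \<otimes> h}"
  with assms show "h \<otimes> k \<in> {h \<in> carrier G. h \<otimes> a = a \<otimes> h}"
    by (simp add: m_assoc) (simp add: m_assoc[symmetric])
qed (use assms in auto)

text \<open>Centralizers are used twice. The centralizer of a generator contains \<open>D\<close>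
  and hence \<open>g\<close>; so the centralizer of \<open>g\<close> contains \<open>D\<close> and
  hence \<open>h\<close>.\<close>

lemma (in group) generate_commute:
  assumes D: "D \<subseteq> carrier G" and comm: "\<And>a b. \<lbrakk>a \<in> D; b \<in> D\<rbrakk> \<Longrightarrow> a \<otimes> b = b \<otimes> a"
    and "g \<in> generate G D" "h \<in> generate G D"
  shows "g \<otimes> h = h \<otimes> g"
proof -
  have *: "g \<otimes> a = a \<otimes> g" if "a \<in> D" for a
    using generate_subgroup_incl[OF _ subgroup_centralizer[of a], of D] that D comm assms(3) by auto
  have "g \<in> carrier G" using assms(3) D generate_in_carrier by blast
  from generate_subgroup_incl[OF _ subgroup_centralizer[OF this], of D] * D assms(4)
  show ?thesis by force
qed

lemma (in group) comm_group_generate: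
  assumes D: "D \<subseteq> carrier G" and comm: "\<And>a b. \<lbrakk>a \<in> D; b \<in> D\<rbrakk> \<Longrightarrow> a \<otimes> b = b \<otimes> a"
  shows "comm_group (G\<lparr>carrier := generate G D\<rparr>)"
  by (rule group.group_comm_groupI[OF subgroup_imp_group[OF generate_is_subgroup[OF D]]])
     (simp add: generate_commute[OF D comm])

section \<open>The additive group of the free Laurent module\<close>

text \<open>The type \<open>laurent\<close> is also that of the free abelian group on the exponents,
  with the monomials as basis, so induction on free abelian groups applies.\<close>

lemma laurent_induct [case_names zero monom diff]:
  fixes q :: laurent
  assumes "P 0" "\<And>n. P (Poly_Mapping.single n 1)" "\<And>p q. \<lbrakk>P p; P q\<rbrakk> \<Longrightarrow> P (p - q)"
  shows "P q"
  by (rule frag_induction[of q UNIV]) (auto intro: assms)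

lemma dsum_induct [case_names zero monom diff]:
  fixes p :: "'a \<Rightarrow>\<^sub>0 laurent"
  assumes zero: "P 0"
    and monom: "\<And>x n. P (Poly_Mapping.single x (Poly_Mapping.single n 1))"
    and diff: "\<And>p q. \<lbrakk>P p; P q\<rbrakk> \<Longrightarrow> P (p - q)"
  shows "P p"
proof -
  have single: "P (Poly_Mapping.single x q)" for x q
    by (induction q rule: laurent_induct) (auto simp: zero monom single_diff intro: diff)
  have add: "P (p + q)" if "P p" "P q" for p q
    using diff[OF that(1) diff[OF zero that(2)]] by simp
  show ?thesis
  proof (induction p rule: update_induct)
    case (update p x q)
    have "Poly_Mapping.update x q p = p + Poly_Mapping.single x q"
      using update(1) by (intro poly_mapping_eqI)
        (auto simp: lookup_update lookup_add lookup_single when_def in_keys_iff)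
    with add[OF update(3) single] show ?case by simp
  qed (rule zero)
qed

text \<open>Additively, the free module is the free abelian group on the pairs
  \<open>(n, x)\<close>, which stand for t^n e_x. Hence the values \<open>T n x\<close> are
  arbitrary and \<phi> is only additive; what multiplication by t becomes under \<phi> depends on
  \<open>T\<close>.\<close>

lemma dsum_hom_exists:
  assumes "comm_group G" and T: "\<And>n x. T n x \<in> carrier G"
  obtains \<phi> :: "('a \<Rightarrow>\<^sub>0 laurent) \<Rightarrow> 'g"
  where "\<And>p. \<phi> p \<in> carrier G" "\<And>p q. \<phi> (p + q) = \<phi> p \<otimes>\<^bsub>G\<^esub> \<phi> q"
    "\<And>n x. \<phi> (Poly_Mapping.single x (Poly_Mapping.single n 1)) = T n x"
proof -
  interpret comm_group G by fact
  obtain h where h: "h \<in> hom (free_Abelian_group UNIV) G"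
    and h_of: "\<And>j. h (frag_of j) = (case j of (n, x) \<Rightarrow> T n x)"
    using free_Abelian_group_universal[of "\<lambda>(n, x). T n x" UNIV] T
    by (metis (no_types, lifting) UNIV_I image_subsetI case_prod_beta')
  \<comment> \<open>Uncurrying identifies the two descriptions. The finite support that
    \<open>Abs_poly_mapping\<close> requires is checked in \<open>lookup_flat\<close>.\<close>
  define flat :: "('a \<Rightarrow>\<^sub>0 laurent) \<Rightarrow> (int \<times> 'a) \<Rightarrow>\<^sub>0 int"
    where "flat p = Abs_poly_mapping (\<lambda>(n, x). Poly_Mapping.lookup (Poly_Mapping.lookup p x) n)" for p
  have lookup_flat: "Poly_Mapping.lookup (flat p) (n, x) = Poly_Mapping.lookup (Poly_Mapping.lookup p x) n"
    for p n x
  proof -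
    have "{j. (case j of (n, x) \<Rightarrow> Poly_Mapping.lookup (Poly_Mapping.lookup p x) n) \<noteq> 0}
        \<subseteq> (\<Union>x\<in>Poly_Mapping.keys p. Poly_Mapping.keys (Poly_Mapping.lookup p x) \<times> {x})"
      by (auto simp: in_keys_iff)
    then have "finite {j. (case j of (n, x) \<Rightarrow> Poly_Mapping.lookup (Poly_Mapping.lookup p x) n) \<noteq> 0}"
      by (rule finite_subset) auto
    then show ?thesis unfolding flat_def by simp
  qed
  have "flat (p + q) = flat p + flat q" for p q
    by (rule poly_mapping_eqI) (auto simp: lookup_flat lookup_add)
  moreover have "flat (Poly_Mapping.single x (Poly_Mapping.single n 1)) = frag_of (n, x)" for n x
  proof (rule poly_mapping_eqI)
    fix j
    show "Poly_Mapping.lookup (flat (Poly_Mapping.single x (Poly_Mapping.single n 1))) j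
        = Poly_Mapping.lookup (frag_of (n, x)) j"
      by (cases j) (simp add: lookup_flat lookup_single when_def)
  qed
  ultimately show thesis
    using h by (intro that[of "h \<circ> flat"]) (auto simp: h_of hom_def Pi_iff)
qed

section \<open>Multiplication by 1 - t\<close>

lemma lookup_laurent_t_mult [simp]:
  "Poly_Mapping.lookup (laurent_t * q) n = Poly_Mapping.lookup q (n - 1)"
proof (induction q rule: laurent_induct)
  case (monom m)
  then show ?case by (auto simp: laurent_t_def mult_single lookup_single when_def)
qed (simp_all add: right_diff_distrib lookup_minus)

text \<open>Consecutive coefficients of \<open>q\<close> can differ only between -1 and 0. So they
  are constant on either side of this gap, and finite support makes both constants vanish; then the
  jump \<open>k\<close> vanishes too.\<close>

lemma one_minus_t_mult_eq_const:
  assumes "(1 - laurent_t) * q = Poly_Mapping.single 0 k"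
  shows "q = 0" "k = 0"
proof -
  have step: "Poly_Mapping.lookup q n - Poly_Mapping.lookup q (n - 1) = (if n = 0 then k else 0)" for n
    using arg_cong[OF assms, of "\<lambda>p. Poly_Mapping.lookup p n"]
    by (auto simp: left_diff_distrib lookup_minus lookup_single when_def)
  obtain N where N: "\<And>n. \<bar>n\<bar> > N \<Longrightarrow> Poly_Mapping.lookup q n = 0"
  proof
    fix n assume n: "\<bar>n\<bar> > Max (insert 0 (abs ` Poly_Mapping.keys q))"
    show "Poly_Mapping.lookup q n = 0"
    proof (rule ccontr)
      assume "Poly_Mapping.lookup q n \<noteq> 0"
      then have "\<bar>n\<bar> \<le> Max (insert 0 (abs ` Poly_Mapping.keys q))"
        by (intro Max_ge) (auto simp: in_keys_iff)
      with n show False by linarith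
    qed
  qed
  have up: "Poly_Mapping.lookup q (int m) = Poly_Mapping.lookup q 0" for m
    using step[of "int (Suc m)" for m] by (induction m) (auto simp: algebra_simps)
  have down: "Poly_Mapping.lookup q (- 1 - int m) = Poly_Mapping.lookup q (- 1)" for m
    using step[of "- 1 - int m" for m] by (induction m) (auto simp: algebra_simps)
  have "Poly_Mapping.lookup q n = 0" for n
  \<comment> \<open>Nothing says that \<open>N\<close> is non-negative, so the indices outside the
    support are formed with its absolute value.\<close>
  proof (cases "n \<ge> 0")
    case True
    then show ?thesis using up[of "nat n"] up[of "nat (\<bar>N\<bar> + 1)"] N[of "\<bar>N\<bar> + 1"] by simp
  next
    case False
    then show ?thesis
      using down[of "nat (- 1 - n)"] down[of "nat \<bar>N\<bar>"] N[of "- 1 - \<bar>N\<bar>"] by simp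
  qed
  then show "q = 0" by (intro poly_mapping_eqI) simp
  with step[of 0] show "k = 0" by simp
qed

text \<open>The intended images of the generators, with \<open>z\<close> placed at the
  origin.\<close>

definition dsum_gen :: "'a \<Rightarrow> 'a \<Rightarrow> ('a \<Rightarrow>\<^sub>0 laurent)" where
  "dsum_gen z x = (if x = z then 0 else Poly_Mapping.single x 1)"

text \<open>In each component, 1 - t times the difference of \<open>a\<close> and \<open>b\<close>
  is an integer constant, so that \<open>one_minus_t_mult_eq_const\<close> applies.\<close>

lemma one_minus_t_scale_add_gen_inject:
  assumes eq: "dsum_scale (1 - laurent_t) a + dsum_gen z i = dsum_scale (1 - laurent_t) b + dsum_gen z j"
  shows "a = b" "i = j"
proof -
  define k :: "'a \<Rightarrow> 'a \<Rightarrow> int" where "k i x = (if x = i \<and> i \<noteq> z then 1 else 0)" for i x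
  have gen: "Poly_Mapping.lookup (dsum_gen z i) x = Poly_Mapping.single 0 (k i x)" for i x
    by (auto simp: dsum_gen_def k_def lookup_single when_def)
  have *: "(1 - laurent_t) * (Poly_Mapping.lookup a x - Poly_Mapping.lookup b x)
      = Poly_Mapping.single 0 (k j x - k i x)" for x
    using arg_cong[OF eq, of "\<lambda>p. Poly_Mapping.lookup p x"]
    by (simp add: lookup_add gen single_diff algebra_simps)
  show "a = b"
    using one_minus_t_mult_eq_const(1)[OF *] by (intro poly_mapping_eqI) simp
  have "k j x = k i x" for x
    using one_minus_t_mult_eq_const(2)[OF *[of x]] by simp
  \<comment> \<open>Both evaluations are needed: if one of the indices is \<open>z\<close>, its
    indicator vanishes and only the other one gives information.\<close>
  from this[of i] this[of j] show "i = j" by (auto simp: k_def split: if_splits)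
qed

section \<open>Translations and the displacement group\<close>

context quandle
begin

text \<open>Restricted to \<open>Q\<close> because the elements of \<open>BijGroup Q\<close> are
  extensional functions.\<close>

definition left_transl :: "'q \<Rightarrow> 'q \<Rightarrow> 'q" where
  "left_transl a = (\<lambda>x\<in>Q. f a x)"

definition dis :: "('q \<Rightarrow> 'q) set" where
  "dis = generate (BijGroup Q)
    {left_transl a \<otimes>\<^bsub>BijGroup Q\<^esub> inv\<^bsub>BijGroup Q\<^esub> left_transl b | a b. a \<in> Q \<and> b \<in> Q}"

lemma left_transl_apply: "x \<in> Q \<Longrightarrow> left_transl a x = f a x"
  by (simp add: left_transl_def)

lemma left_transl_in: "a \<in> Q \<Longrightarrow> left_transl a \<in> carrier (BijGroup Q)"
  unfolding left_transl_def BijGroup_def Bij_def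
  by (auto intro!: bij_betw_byWitness[where f' = "left_div Q f a"]
      simp: left_div_mult mult_left_div left_div_closed closed)

lemma BijGroup_mult_apply:
  "\<lbrakk>\<alpha> \<in> carrier (BijGroup Q); \<beta> \<in> carrier (BijGroup Q); x \<in> Q\<rbrakk> \<Longrightarrow>
    (\<alpha> \<otimes>\<^bsub>BijGroup Q\<^esub> \<beta>) x = \<alpha> (\<beta> x)"
  by (simp add: BijGroup_def compose_eq)

lemma BijGroup_one_apply: "x \<in> Q \<Longrightarrow> \<one>\<^bsub>BijGroup Q\<^esub> x = x"
  by (simp add: BijGroup_def)

lemma BijGroup_closed: "\<lbrakk>\<alpha> \<in> carrier (BijGroup Q); x \<in> Q\<rbrakk> \<Longrightarrow> \<alpha> x \<in> Q"
  using Bij_imp_funcset by (auto simp: BijGroup_def)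

lemma BijGroup_eqI:
  assumes "\<alpha> \<in> carrier (BijGroup Q)" "\<beta> \<in> carrier (BijGroup Q)" "\<And>x. x \<in> Q \<Longrightarrow> \<alpha> x = \<beta> x"
  shows "\<alpha> = \<beta>"
  using assms by (intro extensionalityI[of _ Q]) (auto simp: BijGroup_def Bij_def)

text \<open>Products of translations and their inverses are automorphisms, and an automorphism
  carries the translation by \<open>x\<close> to the translation by the image of
  \<open>x\<close>.\<close>

lemma left_transl_conj_generate:
  assumes "\<alpha> \<in> generate (BijGroup Q) (left_transl ` Q)" "x \<in> Q"
  shows "\<alpha> \<otimes>\<^bsub>BijGroup Q\<^esub> left_transl x = left_transl (\<alpha> x) \<otimes>\<^bsub>BijGroup Q\<^esub> \<alpha>"
proof -
  interpret G: group "BijGroup Q" by (rule group_BijGroup)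
  let ?G = "BijGroup Q"
  note [simp] = left_transl_in BijGroup_closed
  \<comment> \<open>Evaluated at a point, the condition says that \<alpha> preserves
    \<open>f\<close>. So \<open>H\<close> is the automorphism group, and it contains the
    translations by left distributivity.\<close>
  define H where "H = {\<alpha> \<in> carrier ?G. \<forall>x\<in>Q. \<alpha> \<otimes>\<^bsub>?G\<^esub> left_transl x = left_transl (\<alpha> x) \<otimes>\<^bsub>?G\<^esub> \<alpha>}"
  have "subgroup H ?G"
  proof (rule G.subgroupI)
    have "\<one>\<^bsub>?G\<^esub> \<in> H" by (simp add: H_def BijGroup_one_apply)
    then show "H \<noteq> {}" by blast
  next
    fix \<alpha> assume \<alpha>: "\<alpha> \<in> H"
    have "inv\<^bsub>?G\<^esub> \<alpha> \<otimes>\<^bsub>?G\<^esub> left_transl x = left_transl ((inv\<^bsub>?G\<^esub> \<alpha>) x) \<otimes>\<^bsub>?G\<^esub> inv\<^bsub>?G\<^esub> \<alpha>"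
      if x: "x \<in> Q" for x
    proof -
      let ?y = "(inv\<^bsub>?G\<^esub> \<alpha>) x"
      have y: "?y \<in> Q" "\<alpha> ?y = x"
        using \<alpha> x BijGroup_mult_apply[of \<alpha> "inv\<^bsub>?G\<^esub> \<alpha>" x] by (auto simp: H_def BijGroup_one_apply)
      with \<alpha> have "\<alpha> \<otimes>\<^bsub>?G\<^esub> left_transl ?y = left_transl x \<otimes>\<^bsub>?G\<^esub> \<alpha>" by (auto simp: H_def)
      moreover have "\<alpha> \<in> carrier ?G" "left_transl x \<in> carrier ?G" "left_transl ?y \<in> carrier ?G"
        using \<alpha> x y by (auto simp: H_def)
      ultimately show ?thesis
        by (metis G.inv_closed G.inv_solve_left G.inv_solve_right G.m_assoc G.m_closed)
    qed
    with \<alpha> show "inv\<^bsub>?G\<^esub> \<alpha> \<in> H" by (simp add: H_def)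
  next
    fix \<alpha> \<beta> assume "\<alpha> \<in> H" "\<beta> \<in> H"
    then have [simp]: "\<alpha> \<in> carrier ?G" "\<beta> \<in> carrier ?G"
      and \<alpha>: "\<And>x. x \<in> Q \<Longrightarrow> \<alpha> \<otimes>\<^bsub>?G\<^esub> left_transl x = left_transl (\<alpha> x) \<otimes>\<^bsub>?G\<^esub> \<alpha>"
      and \<beta>: "\<And>x. x \<in> Q \<Longrightarrow> \<beta> \<otimes>\<^bsub>?G\<^esub> left_transl x = left_transl (\<beta> x) \<otimes>\<^bsub>?G\<^esub> \<beta>"
      by (auto simp: H_def)
    have "\<alpha> \<otimes>\<^bsub>?G\<^esub> \<beta> \<otimes>\<^bsub>?G\<^esub> left_transl x = left_transl (\<alpha> (\<beta> x)) \<otimes>\<^bsub>?G\<^esub> (\<alpha> \<otimes>\<^bsub>?G\<^esub> \<beta>)"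
      if "x \<in> Q" for x
    proof -
      have "\<alpha> \<otimes>\<^bsub>?G\<^esub> \<beta> \<otimes>\<^bsub>?G\<^esub> left_transl x = \<alpha> \<otimes>\<^bsub>?G\<^esub> left_transl (\<beta> x) \<otimes>\<^bsub>?G\<^esub> \<beta>"
        using that by (simp add: G.m_assoc \<beta>)
      then show ?thesis using that by (simp add: G.m_assoc \<alpha>)
    qed
    then show "\<alpha> \<otimes>\<^bsub>?G\<^esub> \<beta> \<in> H" by (simp add: H_def BijGroup_mult_apply)
  qed (auto simp: H_def)
  moreover have "left_transl ` Q \<subseteq> H"
    unfolding H_def
    by (auto intro!: BijGroup_eqI left_distrib simp: BijGroup_mult_apply left_transl_apply closed)
  ultimately show ?thesis
    using G.generate_subgroup_incl[of "left_transl ` Q" H] assms by (auto simp: H_def)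
qed

lemma dis_incl_generate: "dis \<subseteq> generate (BijGroup Q) (left_transl ` Q)"
proof -
  interpret G: group "BijGroup Q" by (rule group_BijGroup)
  have "subgroup (generate (BijGroup Q) (left_transl ` Q)) (BijGroup Q)"
    by (rule G.generate_is_subgroup) (auto simp: left_transl_in)
  then show ?thesis
    unfolding dis_def
    by (intro G.generate_subgroup_incl) (blast intro: generate.eng generate.incl generate.inv)+
qed

lemma left_transl_mult:
  assumes "a \<in> Q" "b \<in> Q"
  shows "left_transl a \<otimes>\<^bsub>BijGroup Q\<^esub> left_transl b = left_transl (f a b) \<otimes>\<^bsub>BijGroup Q\<^esub> left_transl a"
  using left_transl_conj_generate[of "left_transl a" b] assms
  by (simp add: left_transl_apply generate.incl)

end

text \<open>Mediality says that \<open>L (f x y) L u = L (f x u) L y\<close>. Writing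
  \<open>L (f x v)\<close> as the conjugate of \<open>L v\<close> by \<open>L x\<close> and
  cancelling \<open>L x\<close> gives \<open>swap\<close>: the outer factors of
  \<open>L y (L x)^-1 L u\<close> may be exchanged.\<close>

lemma (in medial_quandle) comm_group_dis: "comm_group ((BijGroup Q)\<lparr>carrier := dis\<rparr>)"
proof -
  interpret G: group "BijGroup Q" by (rule group_BijGroup)
  let ?L = left_transl and ?inv = "\<lambda>x. inv\<^bsub>BijGroup Q\<^esub> x"
  note [simp] = left_transl_in closed
  have swap: "?L y \<otimes>\<^bsub>BijGroup Q\<^esub> ?inv (?L x) \<otimes>\<^bsub>BijGroup Q\<^esub> ?L u
      = ?L u \<otimes>\<^bsub>BijGroup Q\<^esub> ?inv (?L x) \<otimes>\<^bsub>BijGroup Q\<^esub> ?L y"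
    if [simp]: "x \<in> Q" "y \<in> Q" "u \<in> Q" for x y u
  proof -
    have L: "?L (f x v) = ?L x \<otimes>\<^bsub>BijGroup Q\<^esub> ?L v \<otimes>\<^bsub>BijGroup Q\<^esub> ?inv (?L x)" if "v \<in> Q" for v
      using left_transl_mult[of x v] that by (simp add: G.inv_solve_right)
    have "?L (f x y) \<otimes>\<^bsub>BijGroup Q\<^esub> ?L u = ?L (f x u) \<otimes>\<^bsub>BijGroup Q\<^esub> ?L y"
      by (rule BijGroup_eqI) (auto simp: BijGroup_mult_apply left_transl_apply intro: medial)
    then show ?thesis by (simp add: L G.m_assoc)
  qed
  show ?thesis
    unfolding dis_def
  proof (rule G.comm_group_generate)
    fix \<alpha> \<beta>
    assume "\<alpha> \<in> {?L a \<otimes>\<^bsub>BijGroup Q\<^esub> ?inv (?L b) | a b. a \<in> Q \<and> b \<in> Q}"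
      "\<beta> \<in> {?L a \<otimes>\<^bsub>BijGroup Q\<^esub> ?inv (?L b) | a b. a \<in> Q \<and> b \<in> Q}"
    then obtain a b c d where [simp]: "a \<in> Q" "b \<in> Q" "c \<in> Q" "d \<in> Q"
      and \<alpha>: "\<alpha> = ?L a \<otimes>\<^bsub>BijGroup Q\<^esub> ?inv (?L b)" and \<beta>: "\<beta> = ?L c \<otimes>\<^bsub>BijGroup Q\<^esub> ?inv (?L d)"
      by blast
    have "?inv (?L b) \<otimes>\<^bsub>BijGroup Q\<^esub> ?L a \<otimes>\<^bsub>BijGroup Q\<^esub> ?inv (?L d)
        = ?inv (?L d) \<otimes>\<^bsub>BijGroup Q\<^esub> ?L a \<otimes>\<^bsub>BijGroup Q\<^esub> ?inv (?L b)"
      \<comment> \<open>Inverting \<open>swap\<close> gives the same exchange with the outer factors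
        inverted. Both forms together take a b^-1 c d^-1 to c b^-1 a d^-1 and then to c d^-1 a b^-1,
        with letters for translations.\<close>
      using arg_cong[OF swap[of a d b], of ?inv] by (simp add: G.inv_mult_group G.m_assoc)
    then have *: "?L c \<otimes>\<^bsub>BijGroup Q\<^esub> (?inv (?L b) \<otimes>\<^bsub>BijGroup Q\<^esub> ?L a \<otimes>\<^bsub>BijGroup Q\<^esub> ?inv (?L d))
        = ?L c \<otimes>\<^bsub>BijGroup Q\<^esub> (?inv (?L d) \<otimes>\<^bsub>BijGroup Q\<^esub> ?L a \<otimes>\<^bsub>BijGroup Q\<^esub> ?inv (?L b))"
      by simp
    have "\<alpha> \<otimes>\<^bsub>BijGroup Q\<^esub> \<beta> = ?L c \<otimes>\<^bsub>BijGroup Q\<^esub> (?inv (?L b) \<otimes>\<^bsub>BijGroup Q\<^esub> ?L a \<otimes>\<^bsub>BijGroup Q\<^esub> ?inv (?L d))"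
      using arg_cong[OF swap[of b a c], of "\<lambda>x. x \<otimes>\<^bsub>BijGroup Q\<^esub> ?inv (?L d)"] by (simp add: \<alpha> \<beta> G.m_assoc)
    also note *
    finally show "\<alpha> \<otimes>\<^bsub>BijGroup Q\<^esub> \<beta> = \<beta> \<otimes>\<^bsub>BijGroup Q\<^esub> \<alpha>" by (simp add: \<alpha> \<beta> G.m_assoc)
  qed auto
qed

section \<open>The action of the free module\<close>

text \<open>The translation by \<open>\<phi> p (g i)\<close> is
  \<open>\<phi> p L i (\<phi> p)^-1\<close>, and moving a displacement leftwards past
  \<open>L i\<close> multiplies its argument by t. This collects every product into one displacement
  followed by \<open>L j\<close>, which fixes \<open>g j\<close>.\<close>

lemma (in medial_quandle) free_module_action_exists:
  fixes g :: "'i \<Rightarrow> 'a"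
  assumes g: "g ` X \<subseteq> Q" and z: "z \<in> X"
  obtains \<phi> :: "('i \<Rightarrow>\<^sub>0 laurent) \<Rightarrow> 'a \<Rightarrow> 'a"
  where "\<And>p x. x \<in> Q \<Longrightarrow> \<phi> p x \<in> Q" "\<And>x. x \<in> Q \<Longrightarrow> \<phi> 0 x = x"
    "\<And>p q i j. \<lbrakk>i \<in> X; j \<in> X\<rbrakk> \<Longrightarrow> f (\<phi> p (g i)) (\<phi> q (g j)) =
      \<phi> (dsum_scale (1 - laurent_t) p + dsum_scale laurent_t q + dsum_gen z i - dsum_gen z j) (g j)"
proof -
  interpret G: group "BijGroup Q" by (rule group_BijGroup)
  interpret module "dsum_scale :: laurent \<Rightarrow> ('i \<Rightarrow>\<^sub>0 laurent) \<Rightarrow> _" by (rule module_dsum)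
  let ?L = left_transl and ?inv = "\<lambda>x. inv\<^bsub>BijGroup Q\<^esub> x" and ?t = "dsum_scale laurent_t"
  have gQ: "g x \<in> Q" if "x \<in> X" for x using g that by auto
  note [simp] = left_transl_in gQ[OF z]
  \<comment> \<open>\<open>T n x\<close> is the conjugate of \<open>L\<^bsub>x\<^esub> L\<^bsub>z\<^esub>\<^sup>-\<^sup>1\<close> by \<open>L\<^bsub>z\<^esub>\<^sup>n\<close>, written as a generator of \<open>dis\<close>.\<close>
  define P where "P n x = (?L (g z) [^]\<^bsub>BijGroup Q\<^esub> n) (g x)" for n :: int and x
  have PQ: "P n x \<in> Q" if "x \<in> X" for n x
    unfolding P_def using that by (simp add: BijGroup_closed gQ)
  have P_Suc: "P (n + 1) x = f (g z) (P n x)" if "x \<in> X" for n x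
  proof -
    have "?L (g z) [^]\<^bsub>BijGroup Q\<^esub> (n + 1) = ?L (g z) \<otimes>\<^bsub>BijGroup Q\<^esub> ?L (g z) [^]\<^bsub>BijGroup Q\<^esub> n"
      using G.int_pow_mult[of "?L (g z)" 1 n] by (simp add: add.commute)
    then show ?thesis
      using that gQ PQ[OF that, of n] by (simp add: P_def BijGroup_mult_apply left_transl_apply)
  qed
  define T where "T n x = (if x \<in> X then ?L (P n x) \<otimes>\<^bsub>BijGroup Q\<^esub> ?inv (?L (g z)) else \<one>\<^bsub>BijGroup Q\<^esub>)"
    for n x
  have "?L a \<otimes>\<^bsub>BijGroup Q\<^esub> ?inv (?L b) \<in> dis" if "a \<in> Q" "b \<in> Q" for a b
    unfolding dis_def by (rule generate.incl) (use that in blast)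
  then have T_dis: "T n x \<in> carrier ((BijGroup Q)\<lparr>carrier := dis\<rparr>)" for n x
    using PQ[of x n] gQ[OF z] by (simp add: T_def) (simp add: dis_def generate.one)
  obtain \<phi> :: "('i \<Rightarrow>\<^sub>0 laurent) \<Rightarrow> _" where \<phi>_dis: "\<And>p. \<phi> p \<in> dis"
    and \<phi>_add: "\<And>p q. \<phi> (p + q) = \<phi> p \<otimes>\<^bsub>BijGroup Q\<^esub> \<phi> q"
    and \<phi>_single: "\<And>n x. \<phi> (Poly_Mapping.single x (Poly_Mapping.single n 1)) = T n x"
    by (rule dsum_hom_exists[of _ T, OF comm_group_dis T_dis]) auto
  have \<phi>_gen: "\<phi> p \<in> generate (BijGroup Q) (?L ` Q)" for p
    using \<phi>_dis dis_incl_generate by auto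
  have \<phi>_carrier [simp]: "\<phi> p \<in> carrier (BijGroup Q)" for p
    by (rule G.generate_in_carrier[OF _ \<phi>_gen]) auto
  have \<phi>_commute: "\<phi> p \<otimes>\<^bsub>BijGroup Q\<^esub> \<phi> q = \<phi> q \<otimes>\<^bsub>BijGroup Q\<^esub> \<phi> p" for p q
    by (metis \<phi>_add add.commute)
  have \<phi>_zero [simp]: "\<phi> 0 = \<one>\<^bsub>BijGroup Q\<^esub>"
    using \<phi>_add[of 0 0] G.l_cancel_one'[of "\<phi> 0" "\<phi> 0"] by simp
  have \<phi>_diff: "\<phi> (p - q) = \<phi> p \<otimes>\<^bsub>BijGroup Q\<^esub> ?inv (\<phi> q)" for p q
    using \<phi>_add[of "p - q" q] by (simp add: G.inv_solve_right)
  \<comment> \<open>On displacements \<phi> p, multiplication of \<open>p\<close> by t is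
    conjugation by \<open>L (g z)\<close>. By additivity monomials suffice, and there the exponent
    shift is \<open>P_Suc\<close>.\<close>
  have conj_z: "\<phi> (?t p) \<otimes>\<^bsub>BijGroup Q\<^esub> ?L (g z) = ?L (g z) \<otimes>\<^bsub>BijGroup Q\<^esub> \<phi> p" for p
  proof (induction p rule: dsum_induct)
    case (monom x n)
    have *: "?t (Poly_Mapping.single x (Poly_Mapping.single n 1))
        = Poly_Mapping.single x (Poly_Mapping.single (n + 1) 1)"
      by (rule poly_mapping_eqI) (auto simp: lookup_single when_def laurent_t_def mult_single add.commute)
    show ?case
    proof (cases "x \<in> X")
      case True
      have "?L (f (g z) (P n x)) = ?L (g z) \<otimes>\<^bsub>BijGroup Q\<^esub> (?L (P n x) \<otimes>\<^bsub>BijGroup Q\<^esub> ?inv (?L (g z)))"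
        using left_transl_mult[of "g z" "P n x"] PQ[OF True] closed
        by (simp add: G.inv_solve_right flip: G.m_assoc)
      with True PQ[OF True] closed show ?thesis
        unfolding * \<phi>_single by (simp add: T_def P_Suc[OF True] G.m_assoc)
    next
      \<comment> \<open>Outside \<open>X\<close> the default value of \<open>T\<close> is the
        identity, so both sides are \<open>L (g z)\<close>.\<close>
      case False
      then show ?thesis unfolding * \<phi>_single by (simp add: T_def)
    qed
  next
    case (diff p q)
    have "?inv (\<phi> (?t q)) \<otimes>\<^bsub>BijGroup Q\<^esub> ?L (g z) = ?L (g z) \<otimes>\<^bsub>BijGroup Q\<^esub> ?inv (\<phi> q)"
      using diff(2) by (metis G.inv_closed G.inv_solve_left G.inv_solve_right G.m_assoc G.m_closed
          \<phi>_carrier left_transl_in gQ z)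
    then have "\<phi> (?t p) \<otimes>\<^bsub>BijGroup Q\<^esub> ?inv (\<phi> (?t q)) \<otimes>\<^bsub>BijGroup Q\<^esub> ?L (g z)
        = \<phi> (?t p) \<otimes>\<^bsub>BijGroup Q\<^esub> ?L (g z) \<otimes>\<^bsub>BijGroup Q\<^esub> ?inv (\<phi> q)"
      by (simp add: G.m_assoc)
    then show ?case by (simp add: diff(1) scale_right_diff_distrib \<phi>_diff G.m_assoc)
  qed simp
  have gen: "\<phi> (dsum_gen z i) \<otimes>\<^bsub>BijGroup Q\<^esub> ?L (g z) = ?L (g i)" if "i \<in> X" for i
  proof -
    have "Poly_Mapping.single i (1::laurent) = Poly_Mapping.single i (Poly_Mapping.single 0 1)" by simp
    then have "\<phi> (Poly_Mapping.single i 1) = T 0 i" by (simp only: \<phi>_single)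
    with that gQ[OF that] show ?thesis
      by (simp add: dsum_gen_def T_def P_def BijGroup_one_apply G.m_assoc)
  qed
  \<comment> \<open>\<open>L (g i)\<close> and \<open>L (g z)\<close> differ by a displacement,
    which commutes with the others; hence both conjugate alike.\<close>
  have conj: "\<phi> (?t p) \<otimes>\<^bsub>BijGroup Q\<^esub> ?L (g i) = ?L (g i) \<otimes>\<^bsub>BijGroup Q\<^esub> \<phi> p" if "i \<in> X" for p i
  proof -
    have "\<phi> (?t p) \<otimes>\<^bsub>BijGroup Q\<^esub> ?L (g i)
        = \<phi> (?t p) \<otimes>\<^bsub>BijGroup Q\<^esub> \<phi> (dsum_gen z i) \<otimes>\<^bsub>BijGroup Q\<^esub> ?L (g z)"
      by (simp add: gen[OF that, symmetric] G.m_assoc)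
    also have "\<dots> = \<phi> (dsum_gen z i) \<otimes>\<^bsub>BijGroup Q\<^esub> \<phi> (?t p) \<otimes>\<^bsub>BijGroup Q\<^esub> ?L (g z)"
      by (simp only: \<phi>_commute)
    also have "\<dots> = \<phi> (dsum_gen z i) \<otimes>\<^bsub>BijGroup Q\<^esub> ?L (g z) \<otimes>\<^bsub>BijGroup Q\<^esub> \<phi> p"
      by (simp add: conj_z G.m_assoc)
    finally show ?thesis by (simp only: gen[OF that])
  qed
  show thesis
  proof (rule that)
    fix p q i j assume [simp]: "i \<in> X" "j \<in> X"
    let ?x = "\<phi> p (g i)"
      and ?r = "dsum_scale (1 - laurent_t) p + ?t q + dsum_gen z i - dsum_gen z j"
    have [simp]: "?x \<in> Q" by (simp add: BijGroup_closed gQ)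
    \<comment> \<open>Splitting \<open>q\<close> as \<open>p + (q - p)\<close> puts \<phi> p next to
      \<open>L ?x\<close>, where the conjugation rule turns their product into \<phi> p followed by
      \<open>L (g i)\<close>.\<close>
    have "?L ?x \<otimes>\<^bsub>BijGroup Q\<^esub> \<phi> q = ?L ?x \<otimes>\<^bsub>BijGroup Q\<^esub> \<phi> p \<otimes>\<^bsub>BijGroup Q\<^esub> \<phi> (q - p)"
      using \<phi>_add[of p "q - p"] by (simp add: G.m_assoc)
    also have "\<dots> = \<phi> p \<otimes>\<^bsub>BijGroup Q\<^esub> ?L (g i) \<otimes>\<^bsub>BijGroup Q\<^esub> \<phi> (q - p)"
      by (simp add: left_transl_conj_generate[OF \<phi>_gen] gQ)
    also have "\<dots> = \<phi> (p + ?t (q - p) + dsum_gen z i) \<otimes>\<^bsub>BijGroup Q\<^esub> ?L (g z)"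
      by (simp add: G.m_assoc gQ conj[symmetric] \<phi>_add gen)
    also have "p + ?t (q - p) + dsum_gen z i = ?r + dsum_gen z j"
      by (simp add: scale_right_diff_distrib scale_left_diff_distrib)
    also have "\<phi> (?r + dsum_gen z j) \<otimes>\<^bsub>BijGroup Q\<^esub> ?L (g z) = \<phi> ?r \<otimes>\<^bsub>BijGroup Q\<^esub> ?L (g j)"
      by (simp only: \<phi>_add G.m_assoc \<phi>_carrier left_transl_in gQ z gen \<open>j \<in> X\<close>)
    finally have "(?L ?x \<otimes>\<^bsub>BijGroup Q\<^esub> \<phi> q) (g j) = (\<phi> ?r \<otimes>\<^bsub>BijGroup Q\<^esub> ?L (g j)) (g j)"
      by simp
    then show "f ?x (\<phi> q (g j)) = \<phi> ?r (g j)"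
      by (simp add: BijGroup_mult_apply gQ left_transl_apply idem BijGroup_closed)
  qed (simp_all add: BijGroup_closed BijGroup_one_apply)
qed

section \<open>Coordinates in the free medial quandle and the embedding\<close>

lemma affine_hom_inj_on:
  fixes X :: "'a set" and z :: 'a
  assumes z: "z \<in> X"
    and h: "quandle_hom (free_medial_quandle X) (fmq_mult X) (dsum (X - {z})) (aff_op dsum_scale) h"
    and h_Var: "\<And>x. x \<in> X \<Longrightarrow> h (fmq_class X (Var x)) = dsum_gen z x"
  shows "inj_on h (free_medial_quandle X)"
proof -
  let ?F = "free_medial_quandle X" and ?t = laurent_t
  let ?op = "aff_op dsum_scale :: ('a \<Rightarrow>\<^sub>0 laurent) \<Rightarrow> _" and ?g = "\<lambda>x. fmq_class X (Var x)"
  interpret F: medial_quandle ?F "fmq_mult X" by (rule medial_quandle_free)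
  \<comment> \<open>Membership in the full direct sum is automatic; this quandle serves to cancel a
    left factor in the \<open>LDiv\<close> case.\<close>
  interpret U: medial_quandle "dsum UNIV" ?op by (rule medial_quandle_aff_dsum)
  interpret module "dsum_scale :: laurent \<Rightarrow> ('a \<Rightarrow>\<^sub>0 laurent) \<Rightarrow> _" by (rule module_dsum)
  have h_mult: "h (fmq_mult X B C) = ?op (h B) (h C)" if "B \<in> ?F" "C \<in> ?F" for B C
    using h that by (simp add: quandle_hom_def)
  have g: "?g ` X \<subseteq> ?F" by (auto intro!: fmq_class_in simp del: Image_singleton_iff)
  obtain \<phi> :: "('a \<Rightarrow>\<^sub>0 laurent) \<Rightarrow> _" where \<phi>_closed: "\<And>p x. x \<in> ?F \<Longrightarrow> \<phi> p x \<in> ?F"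
    and \<phi>_zero: "\<And>x. x \<in> ?F \<Longrightarrow> \<phi> 0 x = x"
    and \<phi>_mult: "\<And>p q i j. \<lbrakk>i \<in> X; j \<in> X\<rbrakk> \<Longrightarrow> fmq_mult X (\<phi> p (?g i)) (\<phi> q (?g j)) =
      \<phi> (dsum_scale (1 - ?t) p + dsum_scale ?t q + dsum_gen z i - dsum_gen z j) (?g j)"
    using F.free_module_action_exists[OF g z] by blast
  \<comment> \<open>One pair describes both \<open>B\<close> and its image, so equal images with
    unique coordinates force equal elements.\<close>
  define coord where "coord B a i \<longleftrightarrow> i \<in> X \<and> h B = dsum_scale (1 - ?t) a + dsum_gen z i \<and> B = \<phi> a (?g i)"
    for B a i
  \<comment> \<open>Products in the affine quandle transform coordinates by the same rule as
    \<open>\<phi>_mult\<close>.\<close>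
  have aff: "?op (dsum_scale (1 - ?t) a + dsum_gen z i) (dsum_scale (1 - ?t) b + dsum_gen z j)
     = dsum_scale (1 - ?t) (dsum_scale (1 - ?t) a + dsum_scale ?t b + dsum_gen z i - dsum_gen z j)
       + dsum_gen z j" for a b i j
    by (rule poly_mapping_eqI) (simp add: aff_op_def lookup_add lookup_minus algebra_simps)
  have "\<exists>a i. coord (fmq_class X s) a i" if "s \<in> qterms X" for s
    using that
  proof (induction s)
    case (Var x)
    then have "coord (?g x) 0 x"
      by (simp add: coord_def h_Var \<phi>_zero fmq_class_in)
    then show ?case by blast
  next
    case (Mult s t)
    then obtain a i b j where "coord (fmq_class X s) a i" "coord (fmq_class X t) b j" by auto
    then have "coord (fmq_mult X (fmq_class X s) (fmq_class X t))
        (dsum_scale (1 - ?t) a + dsum_scale ?t b + dsum_gen z i - dsum_gen z j) j"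
      using Mult.prems \<phi>_mult[of i j a b] aff[of a i b j]
      unfolding coord_def by (metis h_mult fmq_class_in qterms_simps(2))
    with Mult.prems show ?case by (auto simp: fmq_mult_class simp del: Image_singleton_iff)
  next
    case (LDiv s t)
    then obtain a i b j where s: "coord (fmq_class X s) a i" and t: "coord (fmq_class X t) b j" by auto
    \<comment> \<open>A product takes its index from the right factor, so the quotient has index
      \<open>j\<close>; its other coordinate \<open>c\<close> solves (1 - t) a + t c + e_i - e_j =
      b, which is possible since t is invertible.\<close>
    define c where "c = a + dsum_scale (Poly_Mapping.single (- 1) 1) (b - a - dsum_gen z i + dsum_gen z j)"
    have "dsum_scale ?t c = dsum_scale ?t a + (b - a - dsum_gen z i + dsum_gen z j)"
      unfolding c_def scale_right_distrib scale_scale laurent_t_invertible scale_one ..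
    then have c: "dsum_scale (1 - ?t) a + dsum_scale ?t c + dsum_gen z i - dsum_gen z j = b"
      by (simp add: scale_left_diff_distrib)
    define D where "D = \<phi> c (?g j)"
    have D: "D \<in> ?F" using g t unfolding D_def coord_def by (intro \<phi>_closed) auto
    have sD: "fmq_mult X (fmq_class X s) D = fmq_class X t"
      using s t \<phi>_mult[of i j a c] unfolding coord_def D_def c by metis
    then have "?op (h (fmq_class X s)) (h D) = h (fmq_class X t)"
      using LDiv.prems D by (metis h_mult fmq_class_in qterms_simps(3))
    \<comment> \<open>The expected image of \<open>D\<close> solves the same equation as
      \<open>h D\<close>, so cancellation identifies the two.\<close>
    moreover have "?op (h (fmq_class X s)) (dsum_scale (1 - ?t) c + dsum_gen z j) = h (fmq_class X t)"
      using s t aff[of a i c j] unfolding coord_def c by metis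
    ultimately have "h D = dsum_scale (1 - ?t) c + dsum_gen z j"
      using U.left_div_unique[of "h (fmq_class X s)"] by (metis UNIV_I dsum_def mem_Collect_eq subset_UNIV)
    then have "coord D c j" using t by (simp add: coord_def D_def)
    moreover have "D = fmq_class X (LDiv s t)"
      using LDiv.prems D sD F.left_div_unique left_div_fmq by (metis fmq_class_in qterms_simps(3))
    ultimately show ?case by blast
  qed
  then have coord: "\<exists>a i. coord B a i" if "B \<in> ?F" for B
    using that by (metis fmq_cases)
  show ?thesis
  proof (rule inj_onI)
    fix B C assume "B \<in> ?F" "C \<in> ?F" and eq: "h B = h C"
    then obtain a i b j where "coord B a i" "coord C b j" using coord by blast
    with eq one_minus_t_scale_add_gen_inject[of a z i b j] show "B = C"
      unfolding coord_def by metis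
  qed
qed

theorem theorem3p5:
  fixes X :: "'a set" and z :: 'a
  assumes "z \<in> X"
  shows "\<exists>S. subquandle S (dsum (X - {z})) (aff_op dsum_scale) \<and>
    quandle_isomorphic (free_medial_quandle X) (fmq_mult X) S (aff_op dsum_scale)"
proof -
  let ?F = "free_medial_quandle X" and ?A = "dsum (X - {z})"
  let ?op = "aff_op dsum_scale :: ('a \<Rightarrow>\<^sub>0 laurent) \<Rightarrow> _"
  interpret F: medial_quandle ?F "fmq_mult X" by (rule medial_quandle_free)
  interpret A: medial_quandle ?A ?op by (rule medial_quandle_aff_dsum)
  have "dsum_gen z ` X \<subseteq> ?A" by (simp add: image_subset_iff dsum_gen_def dsum_def)
  then obtain h where h: "quandle_hom ?F (fmq_mult X) ?A ?op h"
    and h_Var: "\<And>x. x \<in> X \<Longrightarrow> h (fmq_class X (Var x)) = dsum_gen z x"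
    using fmq_universal_property(1)[OF medial_quandle_aff_dsum, of "dsum_gen z" X "X - {z}"] by metis
  have h_mult: "h (fmq_mult X B C) = ?op (h B) (h C)" if "B \<in> ?F" "C \<in> ?F" for B C
    using h that by (simp add: quandle_hom_def)
  have h_closed: "h ` ?F \<subseteq> ?A" using h by (simp add: quandle_hom_def)
  have h_left_div: "h (left_div ?F (fmq_mult X) B C) = left_div ?A ?op (h B) (h C)"
    if "B \<in> ?F" "C \<in> ?F" for B C
    by (rule quandle_hom_left_div[OF F.quandle_axioms A.quandle_axioms h that])
  have "inj_on h ?F"
    by (rule affine_hom_inj_on[OF assms h h_Var])
  then have "quandle_isomorphic ?F (fmq_mult X) (h ` ?F) ?op"
    unfolding quandle_isomorphic_def quandle_hom_def
    by (intro exI[of _ h]) (auto simp: h_mult bij_betw_def)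
  moreover have "subquandle (h ` ?F) ?A ?op"
    unfolding subquandle_def
    using h_closed F.closed F.left_div_closed
    by (auto simp: h_mult[symmetric] h_left_div[symmetric])
  ultimately show ?thesis by blast
qed

end
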